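(* Let $1\le p,q\le\infty$ and let $u,v$ be non-negative measurable functions on $\mathbb{R}^n$ for which the Pitt inequality $$\|u^{1/q}\,\widehat f\,\|_q\le C_0\|v^{1/p}f\|_p$$ holds for all $f\in C_0^\infty(\mathbb{R}^n)$, with $C_0$ independent of $f$. Then for every $f\in C_0^\infty(\mathbb{R}^n)$ $$\|f\|_2^2\le C\,\big\|u^{-1/q}\,|\xi|\,\widehat f\,\big\|_{q'}\,\big\|v^{1/p}\,|x|\,f\big\|_p ,$$ where $C$ is independent of $f$.
   Context: The Fourier transform is $\widehat f(\xi)=\int_{\mathbb{R}^n}e^{ix\xi}f(x)\,dx$. $\|\cdot\|_p$ is the norm of $L^p(\mathbb{R}^n)$ and $q'$ is the conjugate exponent of $q$, $1/q+1/q'=1$.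
   Formalization: Functions f for which the right-hand side is the undefined product ∞·0 (first norm infinite, second zero) are excluded; for u = v = 0 the claim has no meaning or fails, and under the Pitt inequality this occurs only when u = 0 almost everywhere. *)

theory Defs
  imports "HOL-Analysis.Analysis" "HOL-Probability.Essential_Supremum"
begin

fun cont_diff :: "nat \<Rightarrow> ('a::euclidean_space \<Rightarrow> 'b::real_normed_vector) \<Rightarrow> bool" where
  "cont_diff 0 f \<longleftrightarrow> continuous_on UNIV f"
| "cont_diff (Suc k) f \<longleftrightarrow> (\<forall>x. f differentiable (at x)) \<and>
     (\<forall>h. cont_diff k (\<lambda>x. frechet_derivative f (at x) h))"

text \<open>The class of complex-valued smooth functions with compact support.\<close>

definition test_function :: "('a::euclidean_space \<Rightarrow> complex) \<Rightarrow> bool" where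
  "test_function f \<longleftrightarrow> (\<forall>k. cont_diff k f) \<and> compact (closure {x. f x \<noteq> 0})"

definition fourier :: "('a::euclidean_space \<Rightarrow> complex) \<Rightarrow> 'a \<Rightarrow> complex" where
  "fourier f \<xi> = (LINT x|lebesgue. exp (\<i> * complex_of_real (x \<bullet> \<xi>)) * f x)"

text \<open>Real powers on \<open>[0, \<infinity>]\<close>, with \<open>x\<^sup>0 = 1\<close> for every \<open>x\<close> (so that a weight
  raised to the power \<open>1/\<infinity>\<close> is the constant 1) and with \<open>0\<^sup>a = \<infinity>\<close> for \<open>a < 0\<close>.
  The library's \<open>powr\<close> instead has \<open>0 powr a = 0\<close> for all \<open>a\<close>.\<close>

definition epow :: "ennreal \<Rightarrow> real \<Rightarrow> ennreal" where
  "epow x a =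
     (if a = 0 then 1
      else if x = 0 then (if a > 0 then 0 else \<infinity>)
      else if x = \<infinity> then (if a > 0 then \<infinity> else 0)
      else ennreal (enn2real x powr a))"

text \<open>\<open>1/p\<close> as a real number for an exponent \<open>p \<in> [1, \<infinity>]\<close>; here \<open>1/\<infinity> = 0\<close>.\<close>

definition recip :: "ennreal \<Rightarrow> real" where
  "recip p = enn2real (1 / p)"

text \<open>The norm of \<open>L\<^sup>p\<close> with values in \<open>[0, \<infinity>]\<close>; the argument \<open>g\<close> is the modulus of the
  function whose norm is taken.\<close>

definition Lp_norm :: "ennreal \<Rightarrow> ('a::euclidean_space \<Rightarrow> ennreal) \<Rightarrow> ennreal" where
  "Lp_norm p g =
     (if p = \<infinity> then esssup lebesgue g
      else epow (\<integral>\<^sup>+ x. epow (g x) (enn2real p) \<partial>lebesgue) (recip p))"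

text \<open>In \<^typ>\<open>ennreal\<close>, \<open>\<infinity> * 0 = 0\<close>. Hence, for \<open>u = v = 0\<close>, the Pitt inequality holds
  trivially while an uncertainty inequality with right-hand side \<open>\<infinity> * 0\<close> would fail. The theorem
  therefore excludes those \<open>f\<close> for which the right-hand side is the undefined product \<open>\<infinity> * 0\<close>;
  under the Pitt inequality such an \<open>f \<noteq> 0\<close> exists only if \<open>u = 0\<close> almost everywhere.\<close>

end

theory Submission
  imports Defs "HOL-Probability.Characteristic_Functions"
begin

text \<open>Fix a unit vector \<open>b\<close> and put \<open>g x = (x \<bullet> b) f x\<close>. Integrating the derivative of
  \<open>(x \<bullet> b) \<bar>f\<bar>\<^sup>2\<close> in direction \<open>b\<close> gives \<open>\<parallel>f\<parallel>\<^sup>2 = - 2 Re \<integral> \<partial>\<^sub>b f \<cdot> cnj g\<close>. On the Fourier side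
  \<open>\<partial>\<^sub>b f\<close> becomes \<open>- \<i> (\<xi> \<bullet> b)\<close> times the transform of \<open>f\<close>, so Hoelder's inequality with the
  weights \<open>u powr (- 1 / q)\<close> and \<open>u powr (1 / q)\<close>, followed by the Pitt inequality for the test
  function \<open>g\<close>, bounds the right-hand side. Instead of Plancherel's theorem the inequality
  \<open>\<bar>\<integral> h \<cdot> cnj g\<bar> \<le> \<integral> \<bar>fourier h\<bar> \<bar>fourier g\<bar>\<close> is enough. The right-hand side is the
  \<open>L\<^sup>1\<close> norm of the transform of the correlation \<open>F z = \<integral> h (x + z) cnj (g x) dx\<close>, and
  it bounds \<open>F 0\<close> by testing dilates of \<open>F\<close> against a Gaussian.\<close>

section \<open>Fourier transforms of integrable functions\<close>

text \<open>A Borel integrand has the same integral under Lebesgue measure and under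
  \<open>lborel\<close>. On \<open>lborel\<close> the product measurability and Fubini arguments
  below are available.\<close>

lemma fourier_lborel:
  fixes f :: "'a::euclidean_space \<Rightarrow> complex"
  assumes "f \<in> borel_measurable borel"
  shows "fourier f \<xi> = (LINT x|lborel. exp (\<i> * complex_of_real (x \<bullet> \<xi>)) * f x)"
proof -
  note assms[measurable]
  have "(\<lambda>x. exp (\<i> * complex_of_real (x \<bullet> \<xi>)) * f x) \<in> borel_measurable lborel"
    by measurable
  thus ?thesis
    unfolding fourier_def by (rule integral_completion)
qed

lemma integrable_fourier_integrand:
  fixes f :: "'a::euclidean_space \<Rightarrow> complex"
  assumes "integrable lborel f"
  shows "integrable lborel (\<lambda>x. exp (\<i> * complex_of_real (x \<bullet> \<xi>)) * f x)"
proof (rule Bochner_Integration.integrable_bound[OF integrable_norm[OF assms]])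
  have [measurable]: "f \<in> borel_measurable borel"
    using assms by (auto dest: borel_measurable_integrable)
  show "(\<lambda>x. exp (\<i> * complex_of_real (x \<bullet> \<xi>)) * f x) \<in> borel_measurable lborel"
    by measurable
qed (auto simp: norm_mult)

lemma borel_measurable_fourier:
  fixes f :: "'a::euclidean_space \<Rightarrow> complex"
  assumes [measurable]: "f \<in> borel_measurable borel"
  shows "fourier f \<in> borel_measurable borel"
proof -
  have "(\<lambda>\<xi>. LINT x|lborel. exp (\<i> * complex_of_real (x \<bullet> \<xi>)) * f x) \<in> borel_measurable borel"
    by measurable
  thus ?thesis
    by (subst measurable_cong[OF fourier_lborel[OF assms]])
qed

lemma integrable_lborel_pair_mult:
  fixes f :: "'a::euclidean_space \<Rightarrow> 'c::{real_normed_field,banach,second_countable_topology}"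
    and g :: "'b::euclidean_space \<Rightarrow> 'c"
  assumes f: "integrable lborel f" and g: "integrable lborel g"
  shows "integrable (lborel \<Otimes>\<^sub>M lborel) (\<lambda>(x, y). f x * g y)"
proof (rule lborel_pair.Fubini_integrable)
  have [measurable]: "f \<in> borel_measurable borel" "g \<in> borel_measurable borel"
    using f g by (auto dest: borel_measurable_integrable)
  show "(\<lambda>(x, y). f x * g y) \<in> borel_measurable (lborel \<Otimes>\<^sub>M lborel)"
    by measurable
  show "integrable lborel (\<lambda>x. LINT y|lborel. norm (case (x, y) of (x, y) \<Rightarrow> f x * g y))"
    using f by (auto simp: norm_mult)
  show "AE x in lborel. integrable lborel (\<lambda>y. case (x, y) of (x, y) \<Rightarrow> f x * g y)"
    using g by auto
qed

text \<open>The kernel \<open>exp (\<i> * (x \<bullet> \<xi>)) * f x * g \<xi>\<close> has modulus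
  \<open>norm (f x) * norm (g \<xi>)\<close>, which is integrable on the product space, so Fubini
  lets the character be attached to either factor.\<close>

lemma fourier_multiplication_formula:
  fixes f g :: "'a::euclidean_space \<Rightarrow> complex"
  assumes f: "integrable lborel f" and g: "integrable lborel g"
  shows "(LINT \<xi>|lborel. fourier f \<xi> * g \<xi>) = (LINT x|lborel. f x * fourier g x)"
proof -
  have [measurable]: "f \<in> borel_measurable borel" "g \<in> borel_measurable borel"
    using f g by (auto dest: borel_measurable_integrable)
  let ?k = "\<lambda>(x, \<xi>). exp (\<i> * complex_of_real (x \<bullet> \<xi>)) * (f x * g \<xi>)"
  have int: "integrable (lborel \<Otimes>\<^sub>M lborel) ?k"
  proof (rule Bochner_Integration.integrable_bound[OF integrable_lborel_pair_mult[OF f g]])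
    show "?k \<in> borel_measurable (lborel \<Otimes>\<^sub>M lborel)"
      by measurable
  qed (auto simp: norm_mult)
  have "(LINT \<xi>|lborel. fourier f \<xi> * g \<xi>) = (LINT \<xi>|lborel. LINT x|lborel. ?k (x, \<xi>))"
    by (simp add: fourier_lborel flip: integral_mult_left_zero) (simp add: mult_ac)
  also have "\<dots> = (LINT x|lborel. LINT \<xi>|lborel. ?k (x, \<xi>))"
    using lborel_pair.Fubini_integral[of "\<lambda>x y. ?k (x, y)"] int by simp
  also have "\<dots> = (LINT x|lborel. f x * fourier g x)"
    by (simp add: fourier_lborel flip: integral_mult_right_zero) (simp add: mult_ac inner_commute)
  finally show ?thesis .
qed

text \<open>The coordinate map carries the product of one-dimensional Lebesgue measures to
  \<open>lborel\<close>, so a product of functions of single coordinates integrates factor by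
  factor. This reduces Gaussian integrals to dimension one.\<close>

lemma integral_prod_Basis:
  fixes \<psi> :: "'a::euclidean_space \<Rightarrow> real \<Rightarrow> complex"
  assumes int: "\<And>b. b \<in> Basis \<Longrightarrow> integrable lborel (\<psi> b)"
  shows "integrable lborel (\<lambda>x::'a. \<Prod>b\<in>Basis. \<psi> b (x \<bullet> b))"
    and "(LINT x|lborel. (\<Prod>b\<in>Basis. \<psi> b ((x::'a) \<bullet> b))) = (\<Prod>b\<in>Basis. (LINT t|lborel. \<psi> b t))"
proof -
  interpret product_sigma_finite "\<lambda>b::'a. lborel :: real measure"
    by standard
  have [measurable]: "\<psi> b \<in> borel_measurable borel" if "b \<in> Basis" for b
    using int[OF that] by (auto dest: borel_measurable_integrable)
  let ?T = "\<lambda>f. \<Sum>b\<in>Basis. f b *\<^sub>R (b::'a)"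
  have T: "?T \<in> measurable (Pi\<^sub>M Basis (\<lambda>_. lborel)) borel"
    by measurable
  have m: "(\<lambda>x::'a. \<Prod>b\<in>Basis. \<psi> b (x \<bullet> b)) \<in> borel_measurable borel"
    by measurable
  have eq: "(\<Prod>b\<in>Basis. \<psi> b (?T f \<bullet> b)) = (\<Prod>b\<in>Basis. \<psi> b (f b))" for f
    by (intro prod.cong refl) (simp add: inner_sum_left inner_Basis if_distrib cong: if_cong)
  show "integrable lborel (\<lambda>x::'a. \<Prod>b\<in>Basis. \<psi> b (x \<bullet> b))"
    by (subst lborel_eq, subst integrable_distr_eq[OF T m], unfold eq)
       (auto intro: product_integrable_prod int)
  show "(LINT x|lborel. (\<Prod>b\<in>Basis. \<psi> b ((x::'a) \<bullet> b))) = (\<Prod>b\<in>Basis. (LINT t|lborel. \<psi> b t))"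
    by (subst lborel_eq, subst integral_distr[OF T m], unfold eq)
       (auto intro: product_integral_prod int)
qed

section \<open>Dilations, the Gaussian and a Parseval inequality\<close>

lemma integral_lborel_scaleR:
  fixes f :: "'a::euclidean_space \<Rightarrow> 'b::{banach, second_countable_topology}"
  assumes c: "c \<noteq> 0" and f: "integrable lborel f"
  shows "integrable lborel (\<lambda>x. f (c *\<^sub>R x))"
    and "(LINT x|lborel. f (c *\<^sub>R x)) = inverse (\<bar>c\<bar> ^ DIM('a)) *\<^sub>R (LINT x|lborel. f x)"
proof -
  have [measurable]: "f \<in> borel_measurable borel"
    using f by (auto dest: borel_measurable_integrable)
  have *: "lborel = density (distr lborel borel (\<lambda>x::'a. c *\<^sub>R x)) (\<lambda>_. ennreal (\<bar>c\<bar>^DIM('a)))"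
    using lborel_affine[OF c, of 0] by (simp add: ennreal_power)
  have "integrable (density (distr lborel borel (\<lambda>x::'a. c *\<^sub>R x)) (\<lambda>_. ennreal (\<bar>c\<bar>^DIM('a)))) f"
    using f by (subst *[symmetric])
  then have "integrable lborel (\<lambda>x. \<bar>c\<bar> ^ DIM('a) *\<^sub>R f (c *\<^sub>R x))"
    by (simp add: integrable_density integrable_distr_eq)
  from integrable_scaleR_right[OF this, of "inverse (\<bar>c\<bar> ^ DIM('a))"]
  show "integrable lborel (\<lambda>x. f (c *\<^sub>R x))"
    using c by simp
  have "(LINT x|lborel. f x) = (LINT x|density (distr lborel borel (\<lambda>x::'a. c *\<^sub>R x)) (\<lambda>_. ennreal (\<bar>c\<bar>^DIM('a))). f x)"
    by (subst * , rule refl)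
  also have "\<dots> = \<bar>c\<bar>^DIM('a) *\<^sub>R (LINT x|lborel. f (c *\<^sub>R x))"
    by (simp add: integral_density integral_distr)
  finally show "(LINT x|lborel. f (c *\<^sub>R x)) = inverse (\<bar>c\<bar> ^ DIM('a)) *\<^sub>R (LINT x|lborel. f x)"
    using c by simp
qed

text \<open>The version for non-negative integrals is kept separate because it will be applied to
  the modulus of a Fourier transform, whose integral may be infinite.\<close>

lemma nn_integral_lborel_scaleR:
  fixes f :: "'a::euclidean_space \<Rightarrow> ennreal"
  assumes c: "c \<noteq> 0" and [measurable]: "f \<in> borel_measurable borel"
  shows "(\<integral>\<^sup>+x. f x \<partial>lborel) = ennreal (\<bar>c\<bar> ^ DIM('a)) * (\<integral>\<^sup>+x. f (c *\<^sub>R x) \<partial>lborel)"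
proof -
  have *: "lborel = density (distr lborel borel (\<lambda>x::'a. c *\<^sub>R x)) (\<lambda>_. ennreal (\<bar>c\<bar>^DIM('a)))"
    using lborel_affine[OF c, of 0] by (simp add: ennreal_power)
  have "(\<integral>\<^sup>+x. f x \<partial>lborel) = (\<integral>\<^sup>+x. f x \<partial>density (distr lborel borel (\<lambda>x::'a. c *\<^sub>R x)) (\<lambda>_. ennreal (\<bar>c\<bar>^DIM('a))))"
    by (subst * , rule refl)
  thus ?thesis
    by (simp add: nn_integral_density nn_integral_distr nn_integral_cmult)
qed

lemma fourier_scaleR:
  fixes f :: "'a::euclidean_space \<Rightarrow> complex"
  assumes c: "c \<noteq> 0" and f: "integrable lborel f"
  shows "fourier (\<lambda>x. f (c *\<^sub>R x)) \<xi> = inverse (\<bar>c\<bar> ^ DIM('a)) *\<^sub>R fourier f (inverse c *\<^sub>R \<xi>)"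
proof -
  have m: "f \<in> borel_measurable borel"
    using f by (auto dest: borel_measurable_integrable)
  hence "(\<lambda>x. f (c *\<^sub>R x)) \<in> borel_measurable borel"
    by measurable
  moreover have "(c *\<^sub>R x) \<bullet> (inverse c *\<^sub>R \<xi>) = x \<bullet> \<xi>" for x
    using c by simp
  ultimately show ?thesis
    using integral_lborel_scaleR(2)[OF c integrable_fourier_integrand[OF f, of "inverse c *\<^sub>R \<xi>"]]
    by (simp only: fourier_lborel m)
qed

text \<open>This is (2 pi)^(-n/2) exp (- |x|^2 / 2); the product form makes its integral and its
  transform factor over the coordinates.\<close>

definition gauss :: "'a::euclidean_space \<Rightarrow> real" where
  "gauss x = (\<Prod>b\<in>Basis. std_normal_density (x \<bullet> b))"

lemma gauss_bounds: "0 \<le> gauss x" "gauss x \<le> 1"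
proof -
  have "std_normal_density t \<le> 1" for t
  proof -
    have "1 \<le> sqrt (2 * pi)"
      using pi_ge_two by simp
    moreover have "exp (- t\<^sup>2 / 2) \<le> 1"
      by simp
    ultimately have "exp (- t\<^sup>2 / 2) \<le> sqrt (2 * pi)"
      by linarith
    thus ?thesis
      unfolding std_normal_density_def by (simp add: divide_simps)
  qed
  thus "0 \<le> gauss x" "gauss x \<le> 1"
    unfolding gauss_def by (auto intro: prod_nonneg prod_le_1)
qed

lemma integrable_gauss: "integrable lborel (\<lambda>x. complex_of_real (gauss x))"
proof -
  have "integrable lborel (\<lambda>x. complex_of_real (std_normal_density x))"
    using integrable_std_normal_moment[of 0] by simp
  thus ?thesis
    unfolding gauss_def of_real_prod by (intro integral_prod_Basis(1)) auto
qed

text \<open>In one dimension the transform is the characteristic function exp (- s^2 / 2) of the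
  standard normal distribution, that is, sqrt (2 pi) times the density itself. Taking products over
  the basis makes the Gaussian an eigenfunction of the transform.\<close>

lemma fourier_gauss:
  fixes w :: "'a::euclidean_space"
  shows "fourier (\<lambda>x. complex_of_real (gauss x)) w = sqrt (2 * pi) ^ DIM('a) * gauss w"
proof -
  have m: "(\<lambda>x::'a. complex_of_real (gauss x)) \<in> borel_measurable borel"
    unfolding gauss_def by measurable
  have one: "(LINT t|lborel. exp (\<i> * complex_of_real (t * s)) * std_normal_density t)
      = sqrt (2 * pi) * std_normal_density s"
    and one_int: "integrable lborel (\<lambda>t. exp (\<i> * complex_of_real (t * s)) * std_normal_density t)" for s
  proof -
    have "(LINT t|lborel. exp (\<i> * complex_of_real (t * s)) * std_normal_density t)
        = char std_normal_distribution s"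
      unfolding char_def
      by (subst integral_density) (auto simp: scaleR_conv_of_real mult_ac)
    also have "\<dots> = complex_of_real (exp (- (s\<^sup>2) / 2))"
      by (simp only: char_std_normal_distribution)
    also have "\<dots> = sqrt (2 * pi) * std_normal_density s"
      unfolding std_normal_density_def by (simp flip: of_real_mult)
    finally show "(LINT t|lborel. exp (\<i> * complex_of_real (t * s)) * std_normal_density t)
      = sqrt (2 * pi) * std_normal_density s" .
    have "integrable lborel (\<lambda>x. complex_of_real (std_normal_density x))"
      using integrable_std_normal_moment[of 0] by simp
    from integrable_fourier_integrand[OF this, of s]
    show "integrable lborel (\<lambda>t. exp (\<i> * complex_of_real (t * s)) * std_normal_density t)"
      by simp
  qed
  have "exp (\<i> * complex_of_real (x \<bullet> w)) * gauss x =
      (\<Prod>b\<in>Basis. exp (\<i> * complex_of_real ((x \<bullet> b) * (w \<bullet> b))) * std_normal_density (x \<bullet> b))" for x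
    by (simp add: gauss_def prod.distrib euclidean_inner[of x w] sum_distrib_left flip: exp_sum)
  hence "fourier (\<lambda>x. complex_of_real (gauss x)) w =
    (LINT x|lborel. (\<Prod>b\<in>Basis. exp (\<i> * complex_of_real ((x \<bullet> b) * (w \<bullet> b))) * std_normal_density (x \<bullet> b)))"
    by (simp add: fourier_lborel[OF m])
  also have "\<dots> = (\<Prod>b\<in>(Basis::'a set). sqrt (2 * pi) * std_normal_density (w \<bullet> b))"
    by (subst integral_prod_Basis(2)) (simp_all only: one one_int of_real_prod)
  also have "\<dots> = sqrt (2 * pi) ^ DIM('a) * gauss w"
    unfolding gauss_def of_real_prod prod.distrib by simp
  finally show ?thesis .
qed

lemma integral_gauss: "(LINT x|lborel. complex_of_real (gauss (x::'a::euclidean_space))) = 1"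
proof -
  have "integrable lborel (\<lambda>x. complex_of_real (std_normal_density x))"
    using integrable_std_normal_moment[of 0] by simp
  moreover have "(LINT x|lborel. complex_of_real (std_normal_density x)) = 1"
    by simp
  ultimately show ?thesis
    unfolding gauss_def of_real_prod by (subst integral_prod_Basis(2)) auto
qed

text \<open>A one-sided substitute for Fourier inversion at the origin. Averages of
  \<open>F (s *\<^sub>R z)\<close> against the Gaussian tend to \<open>F 0\<close> as s tends to 0,
  while the multiplication formula bounds each of them by the integral of the modulus of the
  transform, uniformly in s.\<close>

lemma norm_at_zero_le_nn_integral_fourier:
  fixes F :: "'a::euclidean_space \<Rightarrow> complex"
  assumes F: "integrable lborel F" and cont: "isCont F 0" and M: "\<And>x. norm (F x) \<le> M"
  shows "ennreal (norm (F 0)) \<le> (\<integral>\<^sup>+\<xi>. ennreal (norm (fourier F \<xi>)) \<partial>lborel)"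
proof -
  have [measurable]: "F \<in> borel_measurable borel"
    using F by (auto dest: borel_measurable_integrable)
  note [measurable] = borel_measurable_fourier[of F]
  have [measurable]: "(gauss :: 'a \<Rightarrow> real) \<in> borel_measurable borel"
    unfolding gauss_def by measurable
  define c where "c = sqrt (2 * pi) ^ DIM('a)"
  have "1 \<le> sqrt (2 * pi)"
    using pi_ge_two by simp
  hence c: "1 \<le> c"
    unfolding c_def by (rule one_le_power)
  define I where "I s = (LINT z|lborel. F (s *\<^sub>R z) * complex_of_real (gauss z))" for s
  have bound: "ennreal (c * norm (I s)) \<le> (\<integral>\<^sup>+\<xi>. ennreal (norm (fourier F \<xi>)) \<partial>lborel)"
    if s: "s > 0" for s
  proof -
    let ?Fs = "\<lambda>x. F (s *\<^sub>R x)"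
    have Fs: "integrable lborel ?Fs"
      using s F by (intro integral_lborel_scaleR) auto
    have "c * I s = (LINT z|lborel. ?Fs z * fourier (\<lambda>x. complex_of_real (gauss x)) z)"
      unfolding I_def fourier_gauss c_def by (simp add: mult_ac flip: integral_mult_right_zero)
    also have "\<dots> = (LINT \<xi>|lborel. fourier ?Fs \<xi> * gauss \<xi>)"
      by (rule fourier_multiplication_formula[OF Fs integrable_gauss, symmetric])
    finally have "ennreal (c * norm (I s)) = ennreal (norm (LINT \<xi>|lborel. fourier ?Fs \<xi> * gauss \<xi>))"
      using c by (metis abs_of_nonneg norm_mult norm_of_real order_trans zero_le_one)
    \<comment> \<open>If the integrand is not integrable, its Bochner integral is 0 by convention
      and the bound still holds.\<close>
    also have "\<dots> \<le> (\<integral>\<^sup>+\<xi>. ennreal (norm (fourier ?Fs \<xi> * gauss \<xi>)) \<partial>lborel)"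
      by (cases "integrable lborel (\<lambda>\<xi>. fourier ?Fs \<xi> * gauss \<xi>)")
         (auto intro: integral_norm_bound_ennreal simp: not_integrable_integral_eq)
    also have "\<dots> \<le> (\<integral>\<^sup>+\<xi>. ennreal (norm (fourier ?Fs \<xi>)) \<partial>lborel)"
      by (intro nn_integral_mono ennreal_leI) (simp add: norm_mult gauss_bounds mult_left_le)
    also have "\<dots> = (\<integral>\<^sup>+\<xi>. ennreal (inverse s ^ DIM('a)) * ennreal (norm (fourier F (inverse s *\<^sub>R \<xi>))) \<partial>lborel)"
      using s by (subst fourier_scaleR[OF _ F])
        (auto simp: ennreal_mult power_inverse abs_mult intro!: nn_integral_cong)
    \<comment> \<open>The Jacobian of the dilation cancels the power of \<open>inverse s\<close>:
      the L^1 norm of the transform is invariant under dilation of \<open>F\<close>, so the bound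
      does not depend on s.\<close>
    also have "\<dots> = (\<integral>\<^sup>+\<xi>. ennreal (norm (fourier F \<xi>)) \<partial>lborel)"
      using s by (subst nn_integral_lborel_scaleR[of "inverse s" "\<lambda>\<xi>. ennreal (norm (fourier F \<xi>))"])
        (auto simp: nn_integral_cmult)
    finally show ?thesis .
  qed
  \<comment> \<open>Continuity at 0 gives pointwise convergence, and \<open>M\<close> times the
    Gaussian dominates. Since the Gaussian has total mass 1, the limit is
    \<open>F 0\<close>.\<close>
  have "(\<lambda>n. I (inverse (real (Suc n)))) \<longlonglongrightarrow> (LINT z|lborel. F 0 * complex_of_real (gauss (z::'a)))"
    unfolding I_def
  proof (rule integral_dominated_convergence[where w = "\<lambda>z. M * gauss z"])
    show "integrable lborel (\<lambda>z::'a. M * gauss z)"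
      by (intro integrable_mult_right)
         (use integrable_norm[OF integrable_gauss] in \<open>simp add: gauss_bounds\<close>)
    show "AE z in lborel. (\<lambda>n. F (inverse (real (Suc n)) *\<^sub>R z) * complex_of_real (gauss z)) \<longlonglongrightarrow> F 0 * complex_of_real (gauss z)"
    proof (intro AE_I2 tendsto_mult tendsto_const isCont_tendsto_compose[OF cont])
      show "(\<lambda>n. inverse (real (Suc n)) *\<^sub>R z) \<longlonglongrightarrow> 0" for z :: 'a
        using tendsto_scaleR[OF LIMSEQ_inverse_real_of_nat tendsto_const[of z]] by simp
    qed
    show "AE z in lborel. norm (F (inverse (real (Suc n)) *\<^sub>R z) * complex_of_real (gauss z)) \<le> M * gauss z" for n
      by (intro AE_I2) (simp add: norm_mult gauss_bounds M mult_right_mono)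
  qed auto
  also have "(LINT z|lborel. F 0 * complex_of_real (gauss (z::'a))) = F 0"
    by (simp only: integral_mult_right_zero integral_gauss mult_1_right)
  finally have "(\<lambda>n. ennreal (c * norm (I (inverse (real (Suc n)))))) \<longlonglongrightarrow> ennreal (c * norm (F 0))"
    by (intro tendsto_intros)
  hence "ennreal (c * norm (F 0)) \<le> (\<integral>\<^sup>+\<xi>. ennreal (norm (fourier F \<xi>)) \<partial>lborel)"
    by (rule LIMSEQ_le_const2) (auto intro!: bound)
  \<comment> \<open>The factor (2 pi)^(n/2) is at least 1 and is discarded.\<close>
  moreover have "norm (F 0) \<le> c * norm (F 0)"
    using c by (simp add: mult_le_cancel_right1)
  ultimately show ?thesis
    by (meson ennreal_leI order_trans)
qed

text \<open>The correlation \<open>F\<close> of \<open>h\<close> and \<open>g\<close> takes the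
  left-hand integral as its value at 0, and its transform is
  \<open>fourier h \<xi> * cnj (fourier g \<xi>)\<close>. The bound and the continuity of
  \<open>h\<close> pass to \<open>F\<close>, so the estimate at the origin applies.\<close>

lemma parseval_inequality:
  fixes g h :: "'a::euclidean_space \<Rightarrow> complex"
  assumes g: "integrable lborel g" and h: "integrable lborel h"
    and cont: "continuous_on UNIV h" and M: "\<And>x. norm (h x) \<le> M"
  shows "ennreal (norm (LINT x|lborel. h x * cnj (g x)))
    \<le> (\<integral>\<^sup>+\<xi>. ennreal (norm (fourier h \<xi>)) * ennreal (norm (fourier g \<xi>)) \<partial>lborel)"
proof -
  have [measurable]: "g \<in> borel_measurable borel" "h \<in> borel_measurable borel"
    using g h by (auto dest: borel_measurable_integrable)
  have [measurable]: "cnj \<in> borel_measurable borel"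
    by (intro borel_measurable_continuous_onI continuous_intros)
  define F where "F z = (LINT x|lborel. h (x + z) * cnj (g x))" for z
  have [measurable]: "F \<in> borel_measurable borel"
    unfolding F_def by measurable
  have shift: "integrable lborel (\<lambda>z. k (x + z))" "(LINT z|lborel. k (x + z)) = (LINT z|lborel. k z)"
    if k: "integrable lborel k" for k :: "'a \<Rightarrow> complex" and x
  proof -
    have [measurable]: "k \<in> borel_measurable borel"
      using k by (auto dest: borel_measurable_integrable)
    have "integrable (distr lborel borel ((+) x)) k"
      using k by (simp add: lborel_distr_plus)
    thus "integrable lborel (\<lambda>z. k (x + z))"
      by (simp add: integrable_distr_eq)
    have "(LINT z|lborel. k z) = (LINT z|distr lborel borel ((+) x). k z)"
      by (simp add: lborel_distr_plus)
    thus "(LINT z|lborel. k (x + z)) = (LINT z|lborel. k z)"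
      by (simp add: integral_distr)
  qed
  have normshift: "(LINT z|lborel. norm (h (x + z))) = (LINT z|lborel. norm (h z))" for x
    using shift(2)[of "\<lambda>z. complex_of_real (norm (h z))" x] h by simp
  \<comment> \<open>By translation invariance the inner integral of the modulus over z is the L^1
    norm of \<open>h\<close> times \<open>norm (g x)\<close>, which is integrable in x.\<close>
  have pair: "integrable (lborel \<Otimes>\<^sub>M lborel) (\<lambda>(x, z). h (x + z) * cnj (g x))"
  proof (rule lborel_pair.Fubini_integrable)
    show "integrable lborel (\<lambda>x. LINT z|lborel. norm (case (x, z) of (x, z) \<Rightarrow> h (x + z) * cnj (g x)))"
      using g by (simp add: norm_mult normshift)
  qed (use shift(1)[OF h] in auto)
  have F: "integrable lborel F"
    unfolding F_def using lborel_pair.integrable_snd[OF pair] by simp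
  have FM: "norm (F z) \<le> M * (LINT x|lborel. norm (g x))" for z
  proof -
    have le: "norm (h (x + z) * cnj (g x)) \<le> M * norm (g x)" for x
      using M by (auto simp: norm_mult intro!: mult_right_mono)
    have "integrable lborel (\<lambda>x. h (x + z) * cnj (g x))"
      by (rule Bochner_Integration.integrable_bound[of lborel "\<lambda>x. M * norm (g x)"])
         (use g le in \<open>auto intro: order_trans[OF _ abs_ge_self]\<close>)
    hence "norm (F z) \<le> (LINT x|lborel. M * norm (g x))"
      unfolding F_def using g le by (intro order_trans[OF integral_norm_bound] integral_mono) auto
    thus ?thesis by simp
  qed
  have "isCont F 0"
  proof (rule continuous_at_sequentiallyI)
    fix u :: "nat \<Rightarrow> 'a" assume u: "u \<longlonglongrightarrow> 0"
    show "(\<lambda>n. F (u n)) \<longlonglongrightarrow> F 0"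
      unfolding F_def
    proof (rule integral_dominated_convergence[where w = "\<lambda>x. M * norm (g x)"])
      show "AE x in lborel. (\<lambda>n. h (x + u n) * cnj (g x)) \<longlonglongrightarrow> h (x + 0) * cnj (g x)"
        using u cont
        by (intro AE_I2 tendsto_intros isCont_tendsto_compose[of _ h]) (auto simp: continuous_on_eq_continuous_at)
      show "AE x in lborel. norm (h (x + u n) * cnj (g x)) \<le> M * norm (g x)" for n
        using M by (auto simp: norm_mult intro!: mult_right_mono)
    qed (use g in auto)
  qed
  from norm_at_zero_le_nn_integral_fourier[OF F this FM]
  have "ennreal (norm (F 0)) \<le> (\<integral>\<^sup>+\<xi>. ennreal (norm (fourier F \<xi>)) \<partial>lborel)" .
  moreover have "fourier F \<xi> = fourier h \<xi> * cnj (fourier g \<xi>)" for \<xi>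
  proof -
    let ?e = "\<lambda>x. exp (\<i> * complex_of_real (x \<bullet> \<xi>))"
    \<comment> \<open>The character at z is split as z = (x + z) - x, so that after Fubini the inner
      integral is a translate of the one defining \<open>fourier h \<xi>\<close>.\<close>
    have e: "?e z = cnj (?e x) * ?e (x + z)" for x z
      by (simp add: exp_cnj inner_add_left ring_distribs flip: exp_add)
    have "integrable (lborel \<Otimes>\<^sub>M lborel) (\<lambda>(x, z). ?e z * (h (x + z) * cnj (g x)))"
      by (rule Bochner_Integration.integrable_bound[OF pair]) (auto simp: norm_mult)
    from lborel_pair.Fubini_integral[OF this]
    have "fourier F \<xi> = (LINT x|lborel. LINT z|lborel. ?e z * (h (x + z) * cnj (g x)))"
      by (simp add: fourier_lborel F_def flip: integral_mult_right_zero)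
    also have "\<dots> = (LINT x|lborel. cnj (?e x * g x) * (LINT z|lborel. ?e (x + z) * h (x + z)))"
    proof (rule Bochner_Integration.integral_cong[OF refl])
      fix x
      have "?e z * (h (x + z) * cnj (g x)) = cnj (?e x * g x) * (?e (x + z) * h (x + z))" for z
        by (subst e[of z x]) (simp only: complex_cnj_mult mult_ac)
      hence "(LINT z|lborel. ?e z * (h (x + z) * cnj (g x)))
          = (LINT z|lborel. cnj (?e x * g x) * (?e (x + z) * h (x + z)))"
        by (intro Bochner_Integration.integral_cong refl)
      thus "(LINT z|lborel. ?e z * (h (x + z) * cnj (g x)))
          = cnj (?e x * g x) * (LINT z|lborel. ?e (x + z) * h (x + z))"
        by (simp only: integral_mult_right_zero)
    qed
    also have "\<dots> = (LINT x|lborel. cnj (?e x * g x) * fourier h \<xi>)"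
      by (subst shift(2)[OF integrable_fourier_integrand[OF h]]) (simp add: fourier_lborel)
    also have "\<dots> = fourier h \<xi> * cnj (fourier g \<xi>)"
      by (simp add: fourier_lborel flip: complex_cnj_mult)
    finally show ?thesis .
  qed
  ultimately show ?thesis
    by (simp add: F_def norm_mult ennreal_mult)
qed

section \<open>Smooth functions with compact support\<close>

lemma integrable_compact_support:
  fixes f :: "'a::euclidean_space \<Rightarrow> 'b::{banach, second_countable_topology}"
  assumes "continuous_on UNIV f" and "compact S" and "\<And>x. x \<notin> S \<Longrightarrow> f x = 0"
  shows "integrable lborel f"
proof -
  have "integrable lborel (\<lambda>x. indicator S x *\<^sub>R f x)"
    using assms by (intro borel_integrable_compact) (auto intro: continuous_on_subset)
  also have "(\<lambda>x. indicator S x *\<^sub>R f x) = f"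
    using assms(3) by (auto simp: indicator_def)
  finally show ?thesis .
qed

lemma bounded_compact_support:
  fixes f :: "'a::euclidean_space \<Rightarrow> 'b::real_normed_vector"
  assumes "continuous_on UNIV f" and "compact S" and "\<And>x. x \<notin> S \<Longrightarrow> f x = 0"
  obtains M where "0 \<le> M" "\<And>x. norm (f x) \<le> M"
proof -
  have "bounded (f ` S)"
    using assms by (intro compact_imp_bounded compact_continuous_image) (auto intro: continuous_on_subset)
  then obtain M where "\<And>x. x \<in> S \<Longrightarrow> norm (f x) \<le> M"
    by (auto simp: bounded_iff)
  hence "norm (f x) \<le> max M 0" for x
    using assms(3)[of x] by (cases "x \<in> S") (auto simp: le_max_iff_disj)
  thus ?thesis
    by (intro that[of "max M 0"]) auto
qed

text \<open>The complement of \<open>S\<close> is open, so \<open>F\<close> agrees with 0 near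
  \<open>x\<close>. In this way derivatives inherit compact support.\<close>

lemma has_derivative_zero_outside_closed:
  assumes "(F has_derivative F') (at x)" and "closed S" and "x \<notin> S" and "\<And>x. x \<notin> S \<Longrightarrow> F x = 0"
  shows "F' = (\<lambda>_. 0)"
proof -
  have "(F has_derivative (\<lambda>_. 0)) (at x)"
    by (rule has_derivative_transform_within_open[of "\<lambda>_. 0" _ _ _ "- S"]) (use assms in auto)
  thus ?thesis
    using assms(1) has_derivative_unique by blast
qed

text \<open>The difference quotients have integral zero by translation invariance and converge
  dominatedly to the derivative.\<close>

lemma integral_directional_derivative:
  fixes F :: "'a::euclidean_space \<Rightarrow> 'b::{banach, second_countable_topology}"
  assumes F': "\<And>x. (F has_derivative F' x) (at x)"
    and cont: "continuous_on UNIV (\<lambda>x. F' x b)"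
    and S: "compact S" and F0: "\<And>x. x \<notin> S \<Longrightarrow> F x = 0"
  shows "(LINT x|lborel. F' x b) = 0"
proof -
  have contF: "continuous_on UNIV F"
    using F' by (meson continuous_at_imp_continuous_on has_derivative_continuous)
  hence [measurable]: "F \<in> borel_measurable borel"
    by (rule borel_measurable_continuous_onI)
  have "F' x b = 0" if "x \<notin> S" for x
    using has_derivative_zero_outside_closed[OF F' compact_imp_closed[OF S] that F0] by simp
  then obtain M where M: "0 \<le> M" "\<And>x. norm (F' x b) \<le> M"
    using bounded_compact_support[OF cont S] by blast
  define t where "t n = inverse (real (Suc n))" for n
  have t: "0 < t n" "t n \<le> 1" for n
    by (auto simp: t_def field_simps)
  have t0: "filterlim t (at 0) sequentially"
    using LIMSEQ_inverse_real_of_nat less_imp_neq[OF t(1)] unfolding t_def[symmetric] by (simp add: filterlim_at)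
  have line: "((\<lambda>s. F (x + s *\<^sub>R b)) has_derivative (\<lambda>h. h *\<^sub>R F' (x + s *\<^sub>R b) b)) (at s)" for x s
  proof -
    have "((\<lambda>s. F (x + s *\<^sub>R b)) has_derivative (\<lambda>h. F' (x + s *\<^sub>R b) (h *\<^sub>R b))) (at s)"
      by (rule has_derivative_compose[of "\<lambda>s. x + s *\<^sub>R b", OF _ F']) (auto intro!: derivative_eq_intros)
    thus ?thesis
      by (simp add: linear_cmul[OF has_derivative_linear[OF F']])
  qed
  define Q where "Q n x = (1 / t n) *\<^sub>R (F (t n *\<^sub>R b + x) - F x)" for n x
  \<comment> \<open>All steps \<open>t n\<close> lie in (0, 1], so this compact set, swept out by
    moving \<open>S\<close> back along \<open>b\<close>, supports every difference quotient
    \<open>Q n\<close>.\<close>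
  let ?S' = "(\<lambda>p. fst p - snd p *\<^sub>R b) ` (S \<times> {0..1::real})"
  have cS': "compact ?S'"
    by (intro compact_continuous_image compact_Times compact_Icc S continuous_intros)
  have bound: "norm (Q n x) \<le> indicator ?S' x * M" for n x
  proof (cases "x \<in> ?S'")
    case False
    have S': "y - s *\<^sub>R b \<in> ?S'" if "y \<in> S" "0 \<le> s" "s \<le> 1" for y s
      using that by (intro image_eqI[of _ _ "(y, s)"]) auto
    have "x \<notin> S"
      using False S'[of x 0] by auto
    moreover have "t n *\<^sub>R b + x \<notin> S"
      using False S'[of "t n *\<^sub>R b + x" "t n"] t[of n] by auto
    ultimately show ?thesis
      using False by (simp add: Q_def F0)
  next
    case True
    \<comment> \<open>Mean value inequality on the line through \<open>x\<close> in direction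
      \<open>b\<close>, along which \<open>M\<close> bounds the derivative everywhere.\<close>
    have "norm (F (x + t n *\<^sub>R b) - F (x + 0 *\<^sub>R b)) \<le> M * norm (t n - 0)"
    proof (rule differentiable_bound[where f = "\<lambda>s. F (x + s *\<^sub>R b)" and S = UNIV
          and f' = "\<lambda>s h. h *\<^sub>R F' (x + s *\<^sub>R b) b"])
      show "((\<lambda>s. F (x + s *\<^sub>R b)) has_derivative (\<lambda>h. h *\<^sub>R F' (x + s *\<^sub>R b) b)) (at s within UNIV)" for s
        by (rule line)
      show "onorm (\<lambda>h. h *\<^sub>R F' (x + s *\<^sub>R b) b) \<le> M" for s
      proof (rule onorm_bound[OF M(1)])
        show "norm (h *\<^sub>R F' (x + s *\<^sub>R b) b) \<le> M * norm h" for h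
          using mult_left_mono[OF M(2) abs_ge_zero] by (simp add: mult.commute)
      qed
    qed (rule convex_UNIV UNIV_I)+
    hence "norm (F (x + t n *\<^sub>R b) - F x) \<le> M * t n"
      using t(1)[of n] by simp
    hence "norm (F (x + t n *\<^sub>R b) - F x) / t n \<le> M"
      using t(1)[of n] by (subst pos_divide_le_eq)
    moreover have "norm (Q n x) = norm (F (x + t n *\<^sub>R b) - F x) / t n"
      using t(1)[of n] by (simp add: Q_def add.commute)
    ultimately show ?thesis
      unfolding indicator_eq_1_iff[THEN iffD2, OF True] by simp
  qed
  have "(\<lambda>n. LINT x|lborel. Q n x) \<longlonglongrightarrow> (LINT x|lborel. F' x b)"
  proof (rule integral_dominated_convergence[where w = "\<lambda>x. indicator ?S' x * M"])
    show "(\<lambda>x. F' x b) \<in> borel_measurable lborel"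
      using cont by (simp add: borel_measurable_continuous_onI)
    show "Q n \<in> borel_measurable lborel" for n
      unfolding Q_def by measurable
    show "integrable lborel (\<lambda>x. indicator ?S' x * M)"
      using borel_integrable_compact[OF cS', of "\<lambda>_. M"] by simp
    show "AE x in lborel. (\<lambda>n. Q n x) \<longlonglongrightarrow> F' x b"
    proof (rule AE_I2)
      fix x
      \<comment> \<open>The derivative of the one-variable function s -> F (x + s b) at s = 0,
        written as a limit and then sampled along \<open>t n\<close>.\<close>
      have "(\<lambda>h. norm (F (x + h *\<^sub>R b) - F x - h *\<^sub>R F' x b) / norm h) \<midarrow>0\<rightarrow> 0"
        using line[of x 0] by (simp add: has_derivative_at)
      from filterlim_compose[OF this t0]
      have lim: "(\<lambda>n. norm (F (x + t n *\<^sub>R b) - F x - t n *\<^sub>R F' x b) / norm (t n)) \<longlonglongrightarrow> 0" .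
      have eq: "norm (F (x + t n *\<^sub>R b) - F x - t n *\<^sub>R F' x b) / norm (t n) = norm (Q n x - F' x b)" for n
      proof -
        have "Q n x - F' x b = (1 / t n) *\<^sub>R (F (x + t n *\<^sub>R b) - F x - t n *\<^sub>R F' x b)"
          using t[of n] by (simp add: Q_def algebra_simps)
        thus ?thesis
          using t[of n] by simp
      qed
      have "(\<lambda>n. Q n x - F' x b) \<longlonglongrightarrow> 0"
        using lim unfolding eq by (rule tendsto_norm_zero_cancel)
      thus "(\<lambda>n. Q n x) \<longlonglongrightarrow> F' x b"
        by (rule LIM_zero_cancel)
    qed
  qed (intro AE_I2 bound)
  moreover have "(LINT x|lborel. Q n x) = 0" for n
  proof -
    have int: "integrable lborel F"
      by (rule integrable_compact_support[OF contF S F0])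
    hence "integrable (distr lborel borel ((+) (t n *\<^sub>R b))) F"
      by (simp add: lborel_distr_plus)
    hence int': "integrable lborel (\<lambda>x. F (t n *\<^sub>R b + x))"
      by (simp add: integrable_distr_eq)
    have "(LINT x|lborel. F x) = (LINT x|distr lborel borel ((+) (t n *\<^sub>R b)). F x)"
      by (simp add: lborel_distr_plus)
    also have "\<dots> = (LINT x|lborel. F (t n *\<^sub>R b + x))"
      by (simp add: integral_distr)
    finally show ?thesis
      using int int' by (simp add: Q_def)
  qed
  ultimately show ?thesis
    by (simp add: LIMSEQ_const_iff)
qed

section \<open>Closure of test functions under multiplication by linear forms\<close>

lemma cont_diff_imp_continuous_on: "cont_diff k f \<Longrightarrow> continuous_on UNIV f"
  by (cases k) (auto intro!: continuous_at_imp_continuous_on differentiable_imp_continuous_within)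

lemma cont_diff_Suc_imp: "cont_diff (Suc k) f \<Longrightarrow> cont_diff k f"
proof (induction k arbitrary: f)
  case 0
  thus ?case
    using cont_diff_imp_continuous_on[of "Suc 0" f] by simp
next
  case (Suc k)
  thus ?case
    by (metis cont_diff.simps(2))
qed

lemma cont_diff_add:
  "cont_diff k f \<Longrightarrow> cont_diff k g \<Longrightarrow> cont_diff k (\<lambda>x. f x + g x)"
proof (induction k arbitrary: f g)
  case (Suc k)
  have "frechet_derivative (\<lambda>x. f x + g x) (at x) h =
      frechet_derivative f (at x) h + frechet_derivative g (at x) h" for x h
    by (subst frechet_derivative_at[symmetric, OF has_derivative_add])
       (use Suc.prems in \<open>auto simp: frechet_derivative_works[symmetric]\<close>)
  thus ?case
    using Suc by auto
qed (auto intro: continuous_on_add)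

lemma cont_diff_scaleR:
  "cont_diff k f \<Longrightarrow> cont_diff k (\<lambda>x. c *\<^sub>R f x)"
proof (induction k arbitrary: f)
  case (Suc k)
  have "frechet_derivative (\<lambda>x. c *\<^sub>R f x) (at x) h = c *\<^sub>R frechet_derivative f (at x) h" for x h
    by (subst frechet_derivative_at[symmetric, OF has_derivative_scaleR_right])
       (use Suc.prems in \<open>auto simp: frechet_derivative_works[symmetric]\<close>)
  thus ?case
    using Suc by auto
qed (auto intro!: continuous_intros)

lemma has_derivative_inner_scaleR:
  assumes "(f has_derivative f') (at x)"
  shows "((\<lambda>x. (x \<bullet> b) *\<^sub>R f x) has_derivative (\<lambda>h. (h \<bullet> b) *\<^sub>R f x + (x \<bullet> b) *\<^sub>R f' h)) (at x)"
  using assms by (auto intro!: derivative_eq_intros)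

text \<open>Differentiating in direction \<open>h\<close> leaves
  \<open>(h \<bullet> b) *\<^sub>R f x\<close> plus the same kind of product with the derivative of
  \<open>f\<close>. The first term is covered because order k + 1 implies order k, the second by the
  induction hypothesis.\<close>

lemma cont_diff_inner_scaleR:
  "cont_diff k f \<Longrightarrow> cont_diff k (\<lambda>x. (x \<bullet> b) *\<^sub>R f x)"
proof (induction k arbitrary: f)
  case (Suc k)
  have D: "(f has_derivative frechet_derivative f (at x)) (at x)" for x
    using Suc.prems by (auto simp: frechet_derivative_works[symmetric])
  have "frechet_derivative (\<lambda>x. (x \<bullet> b) *\<^sub>R f x) (at x) h
      = (h \<bullet> b) *\<^sub>R f x + (x \<bullet> b) *\<^sub>R frechet_derivative f (at x) h" for x h
    by (simp add: frechet_derivative_at[symmetric, OF has_derivative_inner_scaleR[OF D]])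
  moreover have "cont_diff k (\<lambda>x. (h \<bullet> b) *\<^sub>R f x + (x \<bullet> b) *\<^sub>R frechet_derivative f (at x) h)" for h
    using Suc cont_diff_Suc_imp[OF Suc.prems] by (auto intro!: cont_diff_add cont_diff_scaleR)
  moreover have "(\<lambda>x. (x \<bullet> b) *\<^sub>R f x) differentiable (at x)" for x
    by (rule differentiableI[OF has_derivative_inner_scaleR[OF D]])
  ultimately show ?case
    by simp
qed (auto intro!: continuous_intros)

text \<open>This admits \<open>(x \<bullet> b) *\<^sub>R f x\<close> as a test function in the Pitt
  inequality.\<close>

lemma test_function_inner_scaleR:
  assumes "test_function f"
  shows "test_function (\<lambda>x. (x \<bullet> b) *\<^sub>R f x)"
proof -
  have "closure {x. (x \<bullet> b) *\<^sub>R f x \<noteq> 0} \<subseteq> closure {x. f x \<noteq> 0}"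
    by (intro closure_mono) auto
  hence "compact (closure {x. (x \<bullet> b) *\<^sub>R f x \<noteq> 0})"
    using assms unfolding test_function_def compact_eq_bounded_closed
    by (meson bounded_subset closed_closure)
  thus ?thesis
    using assms unfolding test_function_def by (blast intro: cont_diff_inner_scaleR)
qed

section \<open>Integration by parts for test functions\<close>

lemma test_functionD:
  assumes "test_function f"
  shows "(f has_derivative frechet_derivative f (at x)) (at x)"
    and "continuous_on UNIV (\<lambda>x. frechet_derivative f (at x) b)"
    and "continuous_on UNIV f"
proof -
  have "cont_diff (Suc 0) f"
    using assms by (simp only: test_function_def)
  thus "(f has_derivative frechet_derivative f (at x)) (at x)"
    and "continuous_on UNIV (\<lambda>x. frechet_derivative f (at x) b)"
    by (auto simp: frechet_derivative_works[symmetric])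
  show "continuous_on UNIV f"
    using assms by (auto simp: test_function_def intro: cont_diff_imp_continuous_on)
qed

lemma integrable_test_function:
  assumes "test_function f"
  shows "integrable lborel f"
  by (rule integrable_compact_support[where S = "closure {x. f x \<noteq> 0}"])
     (use assms closure_subset[of "{x. f x \<noteq> 0}"] in \<open>auto simp: test_function_def intro: test_functionD(3)\<close>)

text \<open>The derivative along \<open>b\<close> of the character times \<open>f\<close> has
  integral zero. By the product rule it is the character times the derivative of \<open>f\<close>
  plus \<open>\<i> * (b \<bullet> \<xi>)\<close>; the minus sign reflects the positive exponent in
  \<open>fourier\<close>.\<close>

lemma fourier_directional_derivative:
  assumes f: "test_function f"
  shows "fourier (\<lambda>x. frechet_derivative f (at x) b) \<xi> = - \<i> * complex_of_real (\<xi> \<bullet> b) * fourier f \<xi>"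
proof -
  define S where "S = closure {x. f x \<noteq> 0}"
  have S: "compact S" and f0: "\<And>x. x \<notin> S \<Longrightarrow> f x = 0"
    using f closure_subset[of "{x. f x \<noteq> 0}"] by (auto simp: S_def test_function_def)
  note D = test_functionD(1)[OF f] and cont = test_functionD(2)[OF f, of b] test_functionD(3)[OF f]
  let ?h = "\<lambda>x. frechet_derivative f (at x) b"
  let ?e = "\<lambda>x. exp (\<i> * complex_of_real (x \<bullet> \<xi>))"
  have h0: "?h x = 0" if "x \<notin> S" for x
    using has_derivative_zero_outside_closed[OF D compact_imp_closed[OF S] that f0] by simp
  have h: "integrable lborel ?h"
    by (rule integrable_compact_support[OF cont(1) S h0])
  have [measurable]: "f \<in> borel_measurable borel" "?h \<in> borel_measurable borel"
    using cont by (auto intro: borel_measurable_continuous_onI)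
  have "((\<lambda>x. ?e x * f x) has_derivative
      (\<lambda>k. ?e x * frechet_derivative f (at x) k + \<i> * complex_of_real (k \<bullet> \<xi>) * ?e x * f x)) (at x)" for x
  proof -
    have "((\<lambda>x. \<i> * complex_of_real (x \<bullet> \<xi>)) has_derivative (\<lambda>k. \<i> * complex_of_real (k \<bullet> \<xi>))) (at x)"
      by (auto intro!: derivative_eq_intros)
    moreover have "(exp has_derivative (*) (?e x)) (at (\<i> * complex_of_real (x \<bullet> \<xi>)))"
      by (rule has_field_derivative_imp_has_derivative[OF DERIV_exp])
    ultimately have "(?e has_derivative (\<lambda>k. ?e x * (\<i> * complex_of_real (k \<bullet> \<xi>)))) (at x)"
      by (rule has_derivative_compose)
    from has_derivative_mult[OF this D[of x]] show ?thesis
      by (simp add: mult_ac)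
  qed
  \<comment> \<open>Here \<open>this\<close> is the product rule just shown; what remains is
    continuity of the derivative along \<open>b\<close> and vanishing outside
    \<open>S\<close>.\<close>
  note deriv = integral_directional_derivative[OF this _ S, of b]
  have "(LINT x|lborel. ?e x * ?h x + \<i> * complex_of_real (b \<bullet> \<xi>) * ?e x * f x) = 0"
    using cont f0 by (intro deriv continuous_intros) auto
  hence "fourier ?h \<xi> + \<i> * complex_of_real (b \<bullet> \<xi>) * fourier f \<xi> = 0"
    using integrable_fourier_integrand[OF h, of \<xi>]
      integrable_fourier_integrand[OF integrable_test_function[OF f], of \<xi>]
    by (simp add: fourier_lborel mult.assoc)
  thus ?thesis
    by (simp add: add_eq_0_iff inner_commute)
qed

text \<open>The derivative of \<open>(x \<bullet> b) *\<^sub>R (f x * cnj (f x))\<close> along the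
  unit vector \<open>b\<close> is |f|^2 plus twice the real part of the integrand on the right, and
  its integral is zero.\<close>

lemma integral_norm_power2_le:
  assumes f: "test_function f" and b: "norm b = 1"
  shows "(LINT x|lborel. (norm (f x))\<^sup>2)
    \<le> 2 * norm (LINT x|lborel. frechet_derivative f (at x) b * cnj ((x \<bullet> b) *\<^sub>R f x))"
proof -
  define S where "S = closure {x. f x \<noteq> 0}"
  have S: "compact S" and f0: "\<And>x. x \<notin> S \<Longrightarrow> f x = 0"
    using f closure_subset[of "{x. f x \<noteq> 0}"] by (auto simp: S_def test_function_def)
  note D = test_functionD(1)[OF f] and cont = test_functionD(2)[OF f, of b] test_functionD(3)[OF f]
  let ?h = "\<lambda>x. frechet_derivative f (at x) b"
  let ?k = "\<lambda>x. ?h x * cnj ((x \<bullet> b) *\<^sub>R f x)"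
  have "((\<lambda>x. (x \<bullet> b) *\<^sub>R (f x * cnj (f x))) has_derivative
      (\<lambda>k. (k \<bullet> b) *\<^sub>R (f x * cnj (f x)) + (x \<bullet> b) *\<^sub>R
        (f x * cnj (frechet_derivative f (at x) k) + frechet_derivative f (at x) k * cnj (f x)))) (at x)" for x
    by (intro has_derivative_inner_scaleR has_derivative_mult D has_derivative_cnj)
  note deriv = integral_directional_derivative[OF this _ S, of b]
  have "b \<bullet> b = 1"
    using b by (simp add: norm_eq_1)
  hence "(b \<bullet> b) *\<^sub>R (f x * cnj (f x)) + (x \<bullet> b) *\<^sub>R (f x * cnj (?h x) + ?h x * cnj (f x))
      = f x * cnj (f x) + (?k x + cnj (?k x))" for x
    by (simp add: algebra_simps)
  moreover have "(LINT x|lborel. (b \<bullet> b) *\<^sub>R (f x * cnj (f x))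
      + (x \<bullet> b) *\<^sub>R (f x * cnj (?h x) + ?h x * cnj (f x))) = 0"
    using cont f0 by (intro deriv continuous_intros) auto
  ultimately have zero: "(LINT x|lborel. f x * cnj (f x) + (?k x + cnj (?k x))) = 0"
    by (simp only:)
  have k: "integrable lborel ?k"
    using f0 by (intro integrable_compact_support[OF _ S] continuous_intros cont) simp
  have f2: "integrable lborel (\<lambda>x. f x * cnj (f x))"
    using f0 by (intro integrable_compact_support[OF _ S] continuous_intros cont) simp
  define K where "K = (LINT x|lborel. ?k x)"
  define N where "N = (LINT x|lborel. (norm (f x))\<^sup>2)"
  have "complex_of_real N = (LINT x|lborel. f x * cnj (f x))"
    unfolding N_def integral_complex_of_real[symmetric] complex_norm_square ..
  moreover have "cnj K = (LINT x|lborel. cnj (?k x))"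
    unfolding K_def by (rule Bochner_Integration.integral_cnj[symmetric])
  moreover note Bochner_Integration.integral_add[OF f2 Bochner_Integration.integrable_add[OF k integrable_cnj[OF k]]]
    Bochner_Integration.integral_add[OF k integrable_cnj[OF k]]
  ultimately have "complex_of_real N + (K + cnj K) = (LINT x|lborel. f x * cnj (f x) + (?k x + cnj (?k x)))"
    unfolding K_def by presburger
  hence "complex_of_real N = - (K + cnj K)"
    using zero by (simp only: eq_neg_iff_add_eq_0)
  \<comment> \<open>The sum \<open>K + cnj K\<close> is twice the real part of \<open>K\<close>;
    bounding it by \<open>2 * norm K\<close> is the source of the factor 2.\<close>
  hence "norm (complex_of_real N) = norm (- (K + cnj K))"
    by (simp only:)
  also have "\<dots> \<le> norm K + norm (cnj K)"
    unfolding norm_minus_cancel by (rule norm_triangle_ineq)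
  finally have "\<bar>N\<bar> \<le> 2 * norm K"
    by simp
  thus ?thesis
    unfolding N_def K_def by linarith
qed

text \<open>Integration by parts, the Parseval inequality for the derivative of \<open>f\<close> and
  \<open>(x \<bullet> b) *\<^sub>R f x\<close>, and the formula for the transform of a derivative
  are combined. The integrals are non-negative ones with values in [0, \<infinity>], ready for the
  weights.\<close>

lemma nn_integral_norm_power2_le_fourier:
  assumes f: "test_function f" and b: "norm b = 1"
  shows "(\<integral>\<^sup>+x. (ennreal (norm (f x)))\<^sup>2 \<partial>lborel) \<le>
    2 * (\<integral>\<^sup>+\<xi>. ennreal \<bar>\<xi> \<bullet> b\<bar> * ennreal (norm (fourier f \<xi>))
      * ennreal (norm (fourier (\<lambda>x. (x \<bullet> b) *\<^sub>R f x) \<xi>)) \<partial>lborel)"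
proof -
  define S where "S = closure {x. f x \<noteq> 0}"
  have S: "compact S" and f0: "\<And>x. x \<notin> S \<Longrightarrow> f x = 0"
    using f closure_subset[of "{x. f x \<noteq> 0}"] by (auto simp: S_def test_function_def)
  note D = test_functionD(1)[OF f] and cont = test_functionD(2)[OF f, of b] test_functionD(3)[OF f]
  let ?h = "\<lambda>x. frechet_derivative f (at x) b"
  let ?g = "\<lambda>x. (x \<bullet> b) *\<^sub>R f x"
  have h0: "?h x = 0" if "x \<notin> S" for x
    using has_derivative_zero_outside_closed[OF D compact_imp_closed[OF S] that f0] by simp
  have h: "integrable lborel ?h"
    by (rule integrable_compact_support[OF cont(1) S h0])
  have g: "integrable lborel ?g"
    by (rule integrable_test_function[OF test_function_inner_scaleR[OF f]])
  obtain M where M: "\<And>x. norm (?h x) \<le> M"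
    using bounded_compact_support[OF cont(1) S h0] by blast
  have f2: "integrable lborel (\<lambda>x. (norm (f x))\<^sup>2)"
    using f0 by (intro integrable_compact_support[OF _ S] continuous_intros cont) simp
  have "(\<integral>\<^sup>+x. (ennreal (norm (f x)))\<^sup>2 \<partial>lborel) = ennreal (LINT x|lborel. (norm (f x))\<^sup>2)"
    using f2 by (subst ennreal_power) (simp_all add: nn_integral_eq_integral)
  also have "\<dots> \<le> ennreal (2 * norm (LINT x|lborel. ?h x * cnj (?g x)))"
    by (intro ennreal_leI integral_norm_power2_le f b)
  also have "\<dots> = 2 * ennreal (norm (LINT x|lborel. ?h x * cnj (?g x)))"
    by (subst ennreal_mult) simp_all
  also have "\<dots> \<le> 2 * (\<integral>\<^sup>+\<xi>. ennreal (norm (fourier ?h \<xi>)) * ennreal (norm (fourier ?g \<xi>)) \<partial>lborel)"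
    by (intro mult_left_mono parseval_inequality[OF g h cont(1) M]) simp
  also have "\<dots> = 2 * (\<integral>\<^sup>+\<xi>. ennreal \<bar>\<xi> \<bullet> b\<bar> * ennreal (norm (fourier f \<xi>)) * ennreal (norm (fourier ?g \<xi>)) \<partial>lborel)"
    by (simp add: fourier_directional_derivative[OF f] norm_mult ennreal_mult'')
  finally show ?thesis .
qed

section \<open>Weighted Lebesgue norms\<close>

lemma epow_ennreal: "0 \<le> x \<Longrightarrow> 0 < a \<Longrightarrow> epow (ennreal x) a = ennreal (x powr a)"
  by (auto simp: epow_def)

lemma epow_top: "0 < a \<Longrightarrow> epow top a = top"
  by (simp add: epow_def)

lemma epow_eq_0_iff: "0 < a \<Longrightarrow> epow x a = 0 \<longleftrightarrow> x = 0"
  by (cases x) (auto simp: epow_def)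

lemma epow_eq_top_iff: "0 < a \<Longrightarrow> epow x a = top \<longleftrightarrow> x = top"
  by (cases x) (auto simp: epow_def)

lemma epow_one: "epow x 1 = x"
  by (cases x) (auto simp: epow_def)

lemma epow_mono: "0 \<le> a \<Longrightarrow> x \<le> y \<Longrightarrow> epow x a \<le> epow y a"
proof (cases "a = 0")
  case False
  assume "0 \<le> a" "x \<le> y"
  with False show ?thesis
    by (cases x; cases y) (auto simp: epow_ennreal epow_top top_unique intro: powr_mono2 ennreal_leI)
qed (simp add: epow_def)

lemma borel_measurable_epow [measurable]:
  assumes [measurable]: "f \<in> borel_measurable M"
  shows "(\<lambda>x. epow (f x) a) \<in> borel_measurable M"
proof -
  have [measurable]: "Measurable.pred M (\<lambda>x. f x = c)" for c
    using measurable_sets[OF assms, of "{c}"] by (simp add: pred_def vimage_def Int_def conj_commute)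
  show ?thesis
    unfolding epow_def by measurable
qed

lemma recip_simps: "1 \<le> r \<Longrightarrow> recip (ennreal r) = 1 / r" "recip \<infinity> = 0"
  unfolding recip_def using divide_ennreal[of 1 r] by auto

lemma Lp_norm_1: "Lp_norm 1 g = (\<integral>\<^sup>+x. g x \<partial>lebesgue)"
  using recip_simps(1)[of 1] by (simp add: Lp_norm_def epow_one)

lemma Lp_norm_ennreal:
  "1 \<le> r \<Longrightarrow> Lp_norm (ennreal r) g = epow (\<integral>\<^sup>+x. epow (g x) r \<partial>lebesgue) (1 / r)"
  by (simp add: Lp_norm_def recip_simps)

lemma ennreal_exponent_cases [consumes 1, case_names finite top]:
  fixes p :: ennreal
  assumes "1 \<le> p"
  obtains r where "1 \<le> r" "p = ennreal r" | "p = \<infinity>"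
  using assms by (cases p) (auto simp: ennreal_1[symmetric] simp del: ennreal_1)

lemma Lp_norm_mono:
  assumes "1 \<le> p" and "f \<in> borel_measurable lebesgue" and "\<And>x. f x \<le> g x"
  shows "Lp_norm p f \<le> Lp_norm p g"
  using assms(1)
proof (cases rule: ennreal_exponent_cases)
  case (finite r)
  thus ?thesis
    using assms by (auto simp: Lp_norm_ennreal intro!: epow_mono nn_integral_mono)
next
  case top
  thus ?thesis
    using assms by (auto simp: Lp_norm_def intro!: esssup_mono)
qed

text \<open>The value \<infinity> on a set of positive measure would make the integral of the power,
  or the essential supremum, infinite. It will be applied to the factor that carries a negative
  power of \<open>u\<close>, to control the zeros of \<open>u\<close>.\<close>

lemma AE_finite_of_Lp_norm_finite:
  assumes "1 \<le> p" and [measurable]: "f \<in> borel_measurable lebesgue" and "Lp_norm p f \<noteq> \<infinity>"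
  shows "AE x in lebesgue. f x \<noteq> \<infinity>"
  using assms(1)
proof (cases rule: ennreal_exponent_cases)
  case (finite r)
  hence "(\<integral>\<^sup>+x. epow (f x) r \<partial>lebesgue) \<noteq> \<infinity>"
    using assms(3) by (auto simp: Lp_norm_ennreal epow_top)
  from nn_integral_PInf_AE[OF _ this] show ?thesis
    using finite by (simp add: epow_eq_top_iff)
next
  case top
  with assms(3) have "esssup lebesgue f < \<infinity>"
    by (simp add: Lp_norm_def less_top)
  with esssup_AE[of f lebesgue] show ?thesis
    by (auto elim!: eventually_mono simp: less_top)
qed

section \<open>Hoelder's inequality for functions with values in [0, \<infinity>]\<close>

lemma nn_integral_mult_le_esssup:
  assumes [measurable]: "f \<in> borel_measurable M"
  shows "(\<integral>\<^sup>+x. f x * g x \<partial>M) \<le> (\<integral>\<^sup>+x. f x \<partial>M) * esssup M g"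
proof -
  have "(\<integral>\<^sup>+x. f x * g x \<partial>M) \<le> (\<integral>\<^sup>+x. f x * esssup M g \<partial>M)"
    using esssup_AE[of g M] by (intro nn_integral_mono_AE) (auto elim!: eventually_mono intro: mult_left_mono)
  thus ?thesis
    by (simp add: nn_integral_multc)
qed

text \<open>Young's inequality for x / a and y / b, multiplied by a b. Both coefficients are
  positive, so an infinite x or y makes the right-hand side infinite. The scales \<open>a\<close>
  and \<open>b\<close> will be the two norms in Hoelder's inequality.\<close>

lemma Youngs_inequality_ennreal:
  assumes r: "1 < r" "1 < r'" "1 / r + 1 / r' = 1" and ab: "0 < a" "0 < b"
  shows "x * y \<le> ennreal (a * b / (r * a powr r)) * epow x r + ennreal (a * b / (r' * b powr r')) * epow y r'"
proof (cases "x = \<infinity> \<or> y = \<infinity>")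
  case True
  moreover have "0 < a * b / (r * a powr r)" "0 < a * b / (r' * b powr r')"
    using r ab by auto
  ultimately show ?thesis
    using r by (auto simp: epow_top ennreal_mult_eq_top_iff ennreal_mult_top top_unique)
next
  case False
  then obtain s t where st: "0 \<le> s" "0 \<le> t" "x = ennreal s" "y = ennreal t"
    by (cases x; cases y) auto
  have "(s / a) * (t / b) \<le> (s / a) powr r / r + (t / b) powr r' / r'"
    using r ab st by (intro Youngs_inequality) auto
  hence "a * b * ((s / a) * (t / b)) \<le> a * b * ((s / a) powr r / r + (t / b) powr r' / r')"
    using ab by (intro mult_left_mono) auto
  hence "s * t \<le> a * b / (r * a powr r) * s powr r + a * b / (r' * b powr r') * t powr r'"
    using ab st by (simp add: powr_divide ring_distribs mult_ac)
  hence "ennreal (s * t) \<le> ennreal (a * b / (r * a powr r) * s powr r + a * b / (r' * b powr r') * t powr r')"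
    by (rule ennreal_leI)
  thus ?thesis
    using r ab st by (simp add: epow_ennreal flip: ennreal_mult ennreal_plus)
qed

lemma ennreal_one_le_of_inverse_le: "inverse z \<le> 1 \<Longrightarrow> 1 \<le> z" for z :: ennreal
proof (cases z)
  case (real r)
  assume "inverse z \<le> 1"
  with real show ?thesis
    by (cases "r = 0") (auto simp: inverse_ennreal top_unique inverse_le_1_iff ennreal_le_1 ennreal_ge_1 less_le)
qed simp

lemma Holder_inequality:
  fixes f g :: "'a::euclidean_space \<Rightarrow> ennreal"
  assumes "1 \<le> p" "1 \<le> q" and pq: "1 / p + 1 / q = 1"
    and [measurable]: "f \<in> borel_measurable lebesgue" "g \<in> borel_measurable lebesgue"
  shows "(\<integral>\<^sup>+x. f x * g x \<partial>lebesgue) \<le> Lp_norm p f * Lp_norm q g"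
proof -
  have inverse_eq_1: "inverse z = 1 \<longleftrightarrow> z = 1" for z :: ennreal
    by (cases z; cases "z = 0") (auto simp: inverse_ennreal ennreal_eq_1 less_le)
  \<comment> \<open>Conjugacy forces the partner of an infinite exponent to be 1, and makes two
    finite exponents both greater than 1.\<close>
  consider "p = \<infinity>" "q = 1" | "q = \<infinity>" "p = 1"
    | r s where "1 < r" "1 < s" "1 / r + 1 / s = 1" "p = ennreal r" "q = ennreal s"
    using assms(1)
  proof (cases rule: ennreal_exponent_cases)
    case top
    with pq have "q = 1"
      by (simp add: divide_ennreal_def inverse_eq_1)
    thus ?thesis using top that(1) by simp
  next
    case (finite r)
    note r = this
    from assms(2) show ?thesis
    proof (cases rule: ennreal_exponent_cases)
      case top
      with pq have "p = 1"
        by (simp add: divide_ennreal_def inverse_eq_1)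
      thus ?thesis using top that(2) by simp
    next
      case (finite s)
      have "ennreal (1 / r + 1 / s) = 1"
        using pq r finite divide_ennreal[of 1 r] divide_ennreal[of 1 s] by (simp add: ennreal_plus)
      hence eq: "1 / r + 1 / s = 1"
        by (rule iffD1[OF ennreal_eq_1])
      moreover have "1 < r" "1 < s"
      proof -
        have "0 < 1 / r" "0 < 1 / s"
          using r finite by auto
        hence "1 / r < 1" "1 / s < 1"
          using eq by linarith+
        thus "1 < r" "1 < s"
          using r finite by (simp_all add: divide_less_eq)
      qed
      ultimately show ?thesis using that(3) r finite by blast
    qed
  qed
  thus ?thesis
  proof cases
    case 1
    thus ?thesis
      using nn_integral_mult_le_esssup[of g lebesgue f]
      by (simp add: Lp_norm_1 mult.commute) (simp add: Lp_norm_def mult.commute)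
  next
    case 2
    thus ?thesis
      using nn_integral_mult_le_esssup[of f lebesgue g]
      by (simp add: Lp_norm_1) (simp add: Lp_norm_def)
  next
    case (3 r s)
    define I where "I = (\<integral>\<^sup>+x. epow (f x) r \<partial>lebesgue)"
    define J where "J = (\<integral>\<^sup>+x. epow (g x) s \<partial>lebesgue)"
    have norms: "Lp_norm p f = epow I (1 / r)" "Lp_norm q g = epow J (1 / s)"
      using 3 by (simp_all add: Lp_norm_ennreal I_def J_def)
    \<comment> \<open>As \<infinity> * 0 = 0, a vanishing integral is treated first: the product
      then vanishes almost everywhere, even if the other norm is infinite. If neither integral is 0
      and one is infinite, the right-hand side is infinite.\<close>
    consider "I = 0" | "J = 0" | "I \<noteq> 0" "J \<noteq> 0" "I = \<infinity> \<or> J = \<infinity>" | "I \<noteq> 0" "J \<noteq> 0" "I \<noteq> \<infinity>" "J \<noteq> \<infinity>"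
      by blast
    thus ?thesis
    proof cases
      case 1
      hence "AE x in lebesgue. f x = 0"
        using 3 by (simp add: I_def nn_integral_0_iff_AE epow_eq_0_iff)
      hence "(\<integral>\<^sup>+x. f x * g x \<partial>lebesgue) = 0"
        by (subst nn_integral_0_iff_AE) (auto elim!: eventually_mono)
      thus ?thesis by simp
    next
      case 2
      hence "AE x in lebesgue. g x = 0"
        using 3 by (simp add: J_def nn_integral_0_iff_AE epow_eq_0_iff)
      hence "(\<integral>\<^sup>+x. f x * g x \<partial>lebesgue) = 0"
        by (subst nn_integral_0_iff_AE) (auto elim!: eventually_mono)
      thus ?thesis by simp
    next
      case 3
      hence "Lp_norm p f * Lp_norm q g = \<infinity>"
        using \<open>1 < r\<close> \<open>1 < s\<close> by (auto simp: norms epow_top ennreal_mult_eq_top_iff epow_eq_0_iff)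
      thus ?thesis by simp
    next
      case 4
      then obtain i j where ij: "0 < i" "0 < j" "I = ennreal i" "J = ennreal j"
        by (cases I; cases J) auto
      \<comment> \<open>With \<open>a\<close> and \<open>b\<close> equal to the norms, the
        integrated Young inequality yields a b / r + a b / s = a b.\<close>
      define a where "a = i powr (1 / r)"
      define b where "b = j powr (1 / s)"
      have ab: "0 < a" "0 < b" "a powr r = i" "b powr s = j"
        using ij 3 by (auto simp: a_def b_def powr_powr)
      have "(\<integral>\<^sup>+x. f x * g x \<partial>lebesgue) \<le>
          (\<integral>\<^sup>+x. ennreal (a * b / (r * a powr r)) * epow (f x) r
            + ennreal (a * b / (s * b powr s)) * epow (g x) s \<partial>lebesgue)"
        using 3 ab by (intro nn_integral_mono Youngs_inequality_ennreal) auto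
      also have "\<dots> = ennreal (a * b / (r * i)) * I + ennreal (a * b / (s * j)) * J"
        by (simp add: nn_integral_add nn_integral_cmult I_def J_def ab)
      also have "\<dots> = ennreal (a * b * (1 / r + 1 / s))"
        using ij ab 3(1,2) by (simp add: ring_distribs flip: ennreal_mult ennreal_plus)
      also have "\<dots> = ennreal (a * b)"
        by (simp only: \<open>1 / r + 1 / s = 1\<close> mult_1_right)
      also have "\<dots> = Lp_norm p f * Lp_norm q g"
        using ij ab 3(1,2) by (simp add: norms epow_ennreal a_def b_def ennreal_mult)
      finally show ?thesis .
    qed
  qed
qed

section \<open>The uncertainty inequality derived from the Pitt inequality\<close>

theorem theorem6p1:
  fixes u v :: "real ^ 'n \<Rightarrow> real"
    and p q q' :: ennreal
    and C\<^sub>0 :: real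
  assumes "1 \<le> p" and "1 \<le> q"
    and "1 / q + 1 / q' = 1"
    and "u \<in> borel_measurable lebesgue" and "\<And>x. 0 \<le> u x"
    and "v \<in> borel_measurable lebesgue" and "\<And>x. 0 \<le> v x"
    and "0 \<le> C\<^sub>0"
    and pitt: "\<And>f. test_function f \<Longrightarrow>
      Lp_norm q (\<lambda>\<xi>. epow (u \<xi>) (recip q) * ennreal (norm (fourier f \<xi>)))
      \<le> C\<^sub>0 * Lp_norm p (\<lambda>x. epow (v x) (recip p) * ennreal (norm (f x)))"
  shows "\<exists>C::real. C > 0 \<and> (\<forall>f. test_function f \<longrightarrow>
    (let A = Lp_norm q' (\<lambda>\<xi>. epow (u \<xi>) (- recip q) * ennreal (norm \<xi>) * ennreal (norm (fourier f \<xi>)));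
         B = Lp_norm p (\<lambda>x. epow (v x) (recip p) * ennreal (norm x) * ennreal (norm (f x)))
     in \<not> (A = \<infinity> \<and> B = 0) \<longrightarrow>
        (Lp_norm 2 (\<lambda>x. ennreal (norm (f x))))\<^sup>2 \<le> C * A * B))"
proof (intro exI[of _ "2 * C\<^sub>0 + 1"] conjI allI impI)
  \<comment> \<open>The 2 comes from the integration by parts. The added 1 keeps the constant
    positive when \<open>C\<^sub>0 = 0\<close>; positivity also settles the case
    \<open>A = \<infinity>\<close>, where \<open>B \<noteq> 0\<close> makes the right-hand side
    infinite.\<close>
  show "0 < 2 * C\<^sub>0 + 1"
    using \<open>0 \<le> C\<^sub>0\<close> by simp
  fix f :: "real ^ 'n \<Rightarrow> complex"
  assume f: "test_function f"
  note [measurable] = \<open>u \<in> borel_measurable lebesgue\<close> \<open>v \<in> borel_measurable lebesgue\<close>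
  define w where "w = (\<lambda>\<xi>. epow (u \<xi>) (- recip q) * ennreal (norm \<xi>) * ennreal (norm (fourier f \<xi>)))"
  define A where "A = Lp_norm q' w"
  define B where "B = Lp_norm p (\<lambda>x. epow (v x) (recip p) * ennreal (norm x) * ennreal (norm (f x)))"
  have "(Lp_norm 2 (\<lambda>x. ennreal (norm (f x))))\<^sup>2 \<le> ennreal (2 * C\<^sub>0 + 1) * A * B" if "\<not> (A = \<infinity> \<and> B = 0)"
  proof (cases "A = \<infinity>")
    case True
    with that \<open>0 < 2 * C\<^sub>0 + 1\<close> show ?thesis
      by (simp add: ennreal_mult_top ennreal_top_mult ennreal_eq_0_iff)
  next
    case False
    \<comment> \<open>One coordinate direction suffices, since
      \<open>\<bar>\<xi> \<bullet> b\<bar>\<close> and \<open>\<bar>x \<bullet> b\<bar>\<close> are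
      at most the norms of \<open>\<xi>\<close> and \<open>x\<close>.\<close>
    obtain b :: "real ^ 'n" where b: "b \<in> Basis"
      using nonempty_Basis by blast
    define g where "g = (\<lambda>x. (x \<bullet> b) *\<^sub>R f x)"
    have g: "test_function g"
      unfolding g_def by (rule test_function_inner_scaleR[OF f])
    define z where "z = (\<lambda>\<xi>. epow (u \<xi>) (recip q) * ennreal (norm (fourier g \<xi>)))"
    have meas: "h \<in> borel_measurable borel" if "test_function h" for h :: "real ^ 'n \<Rightarrow> complex"
      using integrable_test_function[OF that] by (auto dest: borel_measurable_integrable)
    note mf = meas[OF f] borel_measurable_fourier[OF meas[OF f]] borel_measurable_fourier[OF meas[OF g]]
    have [measurable]: "f \<in> borel_measurable lebesgue" "fourier f \<in> borel_measurable lebesgue"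
      "fourier g \<in> borel_measurable lebesgue"
      using mf by (auto intro: measurable_completion)
    have [measurable]: "(\<lambda>x::real ^ 'n. x) \<in> borel_measurable lebesgue"
      by (rule measurable_completion) simp
    have [measurable]: "w \<in> borel_measurable lebesgue" "z \<in> borel_measurable lebesgue"
      unfolding w_def z_def by measurable
    have q': "1 \<le> q'"
    proof -
      have "inverse q' \<le> 1"
        using \<open>1 / q + 1 / q' = 1\<close> by (metis divide_ennreal_def mult_1 le_iff_add add.commute)
      thus ?thesis
        by (rule ennreal_one_le_of_inverse_le)
    qed
    have "AE \<xi> in lebesgue. w \<xi> \<noteq> \<infinity>"
      by (rule AE_finite_of_Lp_norm_finite[OF q' _ False[unfolded A_def]]) measurable
    \<comment> \<open>Since \<open>\<infinity> * 0 = 0\<close>, the weights do not cancel where \<open>u = 0\<close>; finiteness of \<open>w\<close> forces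
      \<open>\<bar>\<xi>\<bar> \<bar>fourier f \<xi>\<bar> = 0\<close> there.\<close>
    hence AE: "AE \<xi> in lebesgue. ennreal \<bar>\<xi> \<bullet> b\<bar> * ennreal (norm (fourier f \<xi>)) * ennreal (norm (fourier g \<xi>)) \<le> w \<xi> * z \<xi>"
    proof (rule eventually_mono)
      fix \<xi> assume fin: "w \<xi> \<noteq> \<infinity>"
      let ?N = "ennreal (norm \<xi>) * ennreal (norm (fourier f \<xi>))"
      have le: "ennreal \<bar>\<xi> \<bullet> b\<bar> * ennreal (norm (fourier f \<xi>)) \<le> ?N"
        using Basis_le_norm[OF b] by (intro mult_right_mono ennreal_leI) auto
      show "ennreal \<bar>\<xi> \<bullet> b\<bar> * ennreal (norm (fourier f \<xi>)) * ennreal (norm (fourier g \<xi>)) \<le> w \<xi> * z \<xi>"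
      proof (cases "?N = 0")
        case True
        with le have "ennreal \<bar>\<xi> \<bullet> b\<bar> * ennreal (norm (fourier f \<xi>)) = 0"
          by (simp only: le_zero_eq)
        thus ?thesis
          by (simp only: mult_zero_left zero_le)
      next
        case N: False
        have "epow (u \<xi>) (- recip q) * epow (u \<xi>) (recip q) = 1"
        \<comment> \<open>For exponent 0, which is the case \<open>q = \<infinity>\<close>, both
          powers are 1 even where \<open>u\<close> vanishes.\<close>
        proof (cases "recip q = 0")
          case True
          thus ?thesis by (simp add: epow_def)
        next
          case False
          hence r: "0 < recip q"
            by (simp add: recip_def less_le)
          have "u \<xi> \<noteq> 0"
          proof
            assume "u \<xi> = 0"
            hence "w \<xi> = \<infinity> * ?N"
              using r by (simp add: w_def epow_def mult.assoc)
            with fin N show False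
              by (simp add: ennreal_top_mult)
          qed
          with \<open>0 \<le> u \<xi>\<close> r show ?thesis
            by (simp add: epow_def powr_minus flip: ennreal_mult)
        qed
        hence "w \<xi> * z \<xi> = ?N * ennreal (norm (fourier g \<xi>))"
          by (simp add: w_def z_def mult_ac)
        thus ?thesis using le by (simp add: mult_right_mono)
      qed
    qed
    have "(Lp_norm 2 (\<lambda>x. ennreal (norm (f x))))\<^sup>2 = (\<integral>\<^sup>+x. (ennreal (norm (f x)))\<^sup>2 \<partial>lborel)"
    proof -
      have "epow (ennreal t) 2 = (ennreal t)\<^sup>2" if "0 \<le> t" for t
        using that by (simp add: epow_ennreal ennreal_power)
      hence "Lp_norm 2 (\<lambda>x. ennreal (norm (f x))) = epow (\<integral>\<^sup>+x. (ennreal (norm (f x)))\<^sup>2 \<partial>lborel) (1 / 2)"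
        using Lp_norm_ennreal[of 2 "\<lambda>x. ennreal (norm (f x))"] by (simp add: nn_integral_completion)
      moreover have "(epow y (1 / 2))\<^sup>2 = y" for y
        by (cases y) (simp_all add: epow_ennreal epow_top ennreal_power powr_half_sqrt)
      ultimately show ?thesis by simp
    qed
    also have "\<dots> \<le> 2 * (\<integral>\<^sup>+\<xi>. ennreal \<bar>\<xi> \<bullet> b\<bar> * ennreal (norm (fourier f \<xi>)) * ennreal (norm (fourier g \<xi>)) \<partial>lborel)"
      unfolding g_def using b by (intro nn_integral_norm_power2_le_fourier f) simp
    \<comment> \<open>The weight \<open>u\<close> is only Lebesgue measurable, hence the return to
      the completed measure here.\<close>
    also have "\<dots> \<le> 2 * (\<integral>\<^sup>+\<xi>. w \<xi> * z \<xi> \<partial>lebesgue)"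
      using AE by (subst nn_integral_completion[symmetric]) (intro mult_left_mono nn_integral_mono_AE, simp_all)
    also have "\<dots> \<le> 2 * (A * Lp_norm q z)"
      unfolding A_def using \<open>1 / q + 1 / q' = 1\<close>
      by (intro mult_left_mono Holder_inequality q' \<open>1 \<le> q\<close>) (simp_all add: add.commute)
    also have "\<dots> \<le> 2 * (A * (C\<^sub>0 * B))"
    proof -
      \<comment> \<open>The Pitt inequality is applied to \<open>g\<close>, not to \<open>f\<close>:
        this puts the factor \<open>\<bar>x \<bullet> b\<bar>\<close> into the norm weighted by
        \<open>v\<close>.\<close>
      have "Lp_norm q z \<le> C\<^sub>0 * Lp_norm p (\<lambda>x. epow (v x) (recip p) * ennreal (norm (g x)))"
        unfolding z_def by (rule pitt[OF g])
      also have "\<dots> \<le> C\<^sub>0 * B"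
        unfolding B_def
      proof (intro mult_left_mono Lp_norm_mono \<open>1 \<le> p\<close>)
        show "(\<lambda>x. epow (v x) (recip p) * ennreal (norm (g x))) \<in> borel_measurable lebesgue"
          unfolding g_def by measurable
        show "epow (v x) (recip p) * ennreal (norm (g x)) \<le> epow (v x) (recip p) * ennreal (norm x) * ennreal (norm (f x))" for x
          using Basis_le_norm[OF b, of x]
          by (auto simp: g_def mult.assoc mult_right_mono intro!: mult_left_mono simp flip: ennreal_mult)
      qed simp
      finally show ?thesis
        by (intro mult_left_mono) auto
    qed
    also have "\<dots> = ennreal (2 * C\<^sub>0) * A * B"
      using \<open>0 \<le> C\<^sub>0\<close> by (simp add: ennreal_mult mult_ac)
    also have "\<dots> \<le> ennreal (2 * C\<^sub>0 + 1) * A * B"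
      by (intro mult_right_mono ennreal_leI) auto
    finally show ?thesis .
  qed
  thus "let A = Lp_norm q' (\<lambda>\<xi>. epow (u \<xi>) (- recip q) * ennreal (norm \<xi>) * ennreal (norm (fourier f \<xi>)));
         B = Lp_norm p (\<lambda>x. epow (v x) (recip p) * ennreal (norm x) * ennreal (norm (f x)))
     in \<not> (A = \<infinity> \<and> B = 0) \<longrightarrow>
        (Lp_norm 2 (\<lambda>x. ennreal (norm (f x))))\<^sup>2 \<le> (2 * C\<^sub>0 + 1) * A * B"
    unfolding A_def B_def w_def Let_def by blast
qed

end
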